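(* Let $n\ge 3$, let $\mathbb{R}^{n\times n}$ be endowed with the Frobenius norm, and let $$\mathcal{C}=\left\{x\in\mathbb{R}^{n\times n} : x_{ij}\ge 0,\ \sum_{l=1}^n x_{lj}=1 \text{ and } \sum_{l=1}^n x_{il}=1 \text{ for all } i,j\in\{1,\dots,n\}\right\}$$ be the Birkhoff polytope of $n\times n$ doubly stochastic matrices. Then the facial distance of $\mathcal{C}$ satisfies $$\Phi(\mathcal{C})\ \ge\ \frac{1}{\sqrt{n^2-1}}.$$
   Context: For a polytope $\mathcal{C}$, $\mathrm{vert}(\mathcal{C})$ is its set of vertices and $\mathrm{faces}(\mathcal{C})$ is its set of nonempty faces (including $\mathcal{C}$ itself). For $G\in\mathrm{faces}(\mathcal{C})$, $G\neq\mathcal{C}$, $\mathcal{C}[G]:=\mathrm{conv}(\mathrm{vert}(\mathcal{C})\setminus G)$. For sets $S,T$, $\mathrm{dist}(S,T)=\min_{x\in S,\,y\in T}\|x-y\|$. The facial distance of $\mathcal{C}$ is $\Phi(\mathcal{C}):=\min_{G\in\mathrm{faces}(\mathcal{C}),\ G\subsetneq\mathcal{C}}\mathrm{dist}(G,\mathcal{C}[G])$. *)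

theory Defs
  imports "HOL-Analysis.Analysis"
begin

definition vertices :: "'a::euclidean_space set \<Rightarrow> 'a set" where
  "vertices C = {v. v extreme_point_of C}"

text \<open>The empty set is a \<open>face_of\<close> every set, so it is excluded explicitly.\<close>

definition nonempty_faces :: "'a::euclidean_space set \<Rightarrow> 'a set set" where
  "nonempty_faces C = {G. G face_of C \<and> G \<noteq> {}}"

definition opposite_hull :: "'a::euclidean_space set \<Rightarrow> 'a set \<Rightarrow> 'a set" where
  "opposite_hull C G = convex hull (vertices C - G)"

text \<open>
  Intended for polytopes with at least two points: then there are finitely many, and at least
  one, proper nonempty faces, and \<open>setdist\<close> (an infimum) is attained because both arguments
  are nonempty and compact.
\<close>

definition facial_distance :: "'a::euclidean_space set \<Rightarrow> real" where
  "facial_distance C =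
     Min ((\<lambda>G. setdist G (opposite_hull C G)) ` {G \<in> nonempty_faces C. G \<subset> C})"

definition birkhoff_polytope :: "(real^'n^'n) set" where
  "birkhoff_polytope =
     {x. \<forall>i j. x $ i $ j \<ge> 0 \<and> (\<Sum>l\<in>UNIV. x $ l $ j) = 1 \<and> (\<Sum>l\<in>UNIV. x $ i $ l) = 1}"

text \<open>The library's norm on matrices is the Frobenius norm.\<close>

lemma norm_matrix_eq_frobenius:
  fixes x :: "real^'n^'m"
  shows "norm x = sqrt (\<Sum>i\<in>UNIV. \<Sum>j\<in>UNIV. (x $ i $ j)\<^sup>2)"
  by (simp add: norm_vec_def L2_set_def sum_nonneg)

end

theory Submission
  imports Defs
begin

text \<open>
  Every face \<open>G\<close> of the Birkhoff polytope is cut out by prescribing zero entries: it consists of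
  all doubly stochastic matrices whose support lies in the support of a relative interior point
  \<open>x\<close> of \<open>G\<close> (\<open>face_max_support\<close>). Let \<open>w\<close> be the 0/1 matrix of the zero entries of \<open>x\<close>. The
  functional \<open>y \<mapsto> w \<bullet> y\<close> vanishes on \<open>G\<close>. A vertex outside \<open>G\<close> has a nonzero entry where \<open>x\<close> has
  a zero, and that entry equals 1 because vertices have entries 0 and 1 only (\<open>vertex_entries\<close>,
  the essential half of the Birkhoff--von Neumann theorem), so the functional is at least 1 at all
  such vertices and hence on their convex hull. By Cauchy--Schwarz, \<open>G\<close> and the opposite hull
  are at distance at least \<open>1 / norm w\<close>. Since \<open>w\<close> is entrywise at most \<open>1 - x\<close>, it has at most
  \<open>n\<^sup>2 - n \<le> n\<^sup>2 - 1\<close> ones, which bounds \<open>norm w\<close>.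

  For the 0/1 entries of vertices, a dimension count replaces the usual search for a cycle: a
  doubly stochastic matrix with a fractional entry has at least two of them in each row and column
  that contains one, so there are enough fractional entries to carry a nonzero matrix with zero
  row and column sums (\<open>exists_zero_sum_matrix\<close>). Moving a little in both directions along
  that matrix stays in the polytope, so the given matrix is not extreme.
\<close>

section \<open>Doubly stochastic matrices and their perturbations\<close>

definition support :: "real^'n^'n \<Rightarrow> ('n \<times> 'n) set" where
  "support x = {(i, j). x $ i $ j \<noteq> 0}"

lemma birkhoffD:
  assumes "x \<in> birkhoff_polytope"
  shows "x $ i $ j \<ge> 0" "(\<Sum>l\<in>UNIV. x $ l $ j) = 1" "(\<Sum>l\<in>UNIV. x $ i $ l) = 1"
    "x $ i $ j \<le> 1"
proof -
  show nonneg: "x $ i $ j \<ge> 0" for i j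
    using assms by (auto simp: birkhoff_polytope_def)
  show "(\<Sum>l\<in>UNIV. x $ l $ j) = 1"
    using assms by (auto simp: birkhoff_polytope_def)
  show row: "(\<Sum>l\<in>UNIV. x $ i $ l) = 1"
    using assms by (auto simp: birkhoff_polytope_def)
  show "x $ i $ j \<le> 1"
    using member_le_sum[of j UNIV "\<lambda>l. x $ i $ l"] nonneg row by simp
qed

lemma convex_birkhoff_polytope: "convex birkhoff_polytope"
  unfolding convex_def birkhoff_polytope_def
  by (auto simp: sum.distrib simp flip: sum_distrib_left)

lemma compact_birkhoff_polytope: "compact (birkhoff_polytope :: (real^'n^'n) set)"
proof -
  have "closed (birkhoff_polytope :: (real^'n^'n) set)"
    unfolding birkhoff_polytope_def
    by (intro closed_Collect_all closed_Collect_conj closed_Collect_le closed_Collect_eq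
        continuous_intros)
  moreover have "bounded (birkhoff_polytope :: (real^'n^'n) set)"
  proof -
    have "norm x \<le> sqrt (\<Sum>i\<in>(UNIV::'n set). \<Sum>j\<in>(UNIV::'n set). 1)"
      if "x \<in> birkhoff_polytope" for x :: "real^'n^'n"
      unfolding norm_matrix_eq_frobenius
      by (intro real_sqrt_le_mono sum_mono power_le_one birkhoffD[OF that])
    then show ?thesis
      unfolding bounded_iff by blast
  qed
  ultimately show ?thesis
    by (simp add: compact_eq_bounded_closed)
qed

lemma exists_small_multiple:
  fixes x z :: "real^'n^'n"
  assumes nonneg: "\<And>i j. x $ i $ j \<ge> 0" and sub: "support z \<subseteq> support x"
  obtains e where "e > 0" "\<And>i j. e * \<bar>z $ i $ j\<bar> \<le> x $ i $ j"
proof -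
  have "\<forall>\<^sub>F e in at_right 0. e * \<bar>z $ i $ j\<bar> \<le> x $ i $ j" for i j
  proof (cases "x $ i $ j = 0")
    case True
    then have "z $ i $ j = 0"
      using sub by (auto simp: support_def)
    with True show ?thesis by simp
  next
    case False
    have "((\<lambda>e. e * \<bar>z $ i $ j\<bar>) \<longlongrightarrow> 0 * \<bar>z $ i $ j\<bar>) (at_right 0)"
      by (intro tendsto_intros)
    moreover have "0 * \<bar>z $ i $ j\<bar> < x $ i $ j"
      using False nonneg[of i j] by simp
    ultimately show ?thesis
      by (rule eventually_mono[OF order_tendstoD(2)]) simp
  qed
  then have "\<forall>\<^sub>F e in at_right 0. \<forall>i j. e * \<bar>z $ i $ j\<bar> \<le> x $ i $ j"
    by (intro eventually_all_finite)
  then have "\<forall>\<^sub>F e::real in at_right 0. e > 0 \<and> (\<forall>i j. e * \<bar>z $ i $ j\<bar> \<le> x $ i $ j)"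
    by (intro eventually_conj eventually_at_right_less)
  then show ?thesis
    using that by (metis (no_types, lifting) eventually_happens trivial_limit_at_right_real)
qed

lemma birkhoff_perturb:
  fixes x z :: "real^'n^'n"
  assumes x: "x \<in> birkhoff_polytope" and e: "e > 0" "\<And>i j. e * \<bar>z $ i $ j\<bar> \<le> x $ i $ j"
    and row: "\<And>i. (\<Sum>l\<in>UNIV. z $ i $ l) = 0" and col: "\<And>j. (\<Sum>l\<in>UNIV. z $ l $ j) = 0"
  shows "x + e *\<^sub>R z \<in> birkhoff_polytope" "x - e *\<^sub>R z \<in> birkhoff_polytope"
proof -
  have "\<bar>e * z $ i $ j\<bar> \<le> x $ i $ j" for i j
    using e by (simp add: abs_mult)
  then have "0 \<le> x $ i $ j + e * z $ i $ j" "0 \<le> x $ i $ j - e * z $ i $ j" for i j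
    using abs_le_D1[of "e * z $ i $ j"] abs_le_D2[of "e * z $ i $ j"] by (simp_all, force)
  then show "x + e *\<^sub>R z \<in> birkhoff_polytope" "x - e *\<^sub>R z \<in> birkhoff_polytope"
    using birkhoffD(2,3)[OF x] row col unfolding birkhoff_polytope_def
    by (auto simp: sum.distrib sum_subtractf simp flip: sum_distrib_left)
qed

section \<open>Vertices have entries 0 and 1\<close>

text \<open>
  A position \<open>(i, j)\<close> is represented by the vector \<open>(e\<^sub>i, e\<^sub>j)\<close>; the linear relations among these
  vectors are exactly the matrices with zero row and column sums. The vectors of the positions in
  \<open>F\<close> lie in a space of dimension one less than the number of rows and columns met by \<open>F\<close>
  (the edge vectors of a bipartite graph have equal coordinate sums on both sides), so they are
  dependent even when \<open>card F\<close> merely equals that number.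
\<close>

lemma exists_zero_sum_matrix:
  fixes F :: "('n::finite \<times> 'n) set"
  assumes nonempty: "F \<noteq> {}" and card: "card (fst ` F) + card (snd ` F) \<le> card F"
  obtains z :: "real^'n^'n" where "z \<noteq> 0" "support z \<subseteq> F"
    "\<And>i. (\<Sum>l\<in>UNIV. z $ i $ l) = 0" "\<And>j. (\<Sum>l\<in>UNIV. z $ l $ j) = 0"
proof -
  define v :: "'n \<times> 'n \<Rightarrow> (real^'n) \<times> (real^'n)" where
    "v = (\<lambda>(i, j). (axis i 1, axis j 1))"
  obtain j0 where j0: "j0 \<in> snd ` F"
    using nonempty by auto
  \<comment> \<open>Through a fixed column \<open>j0\<close>: \<open>(e\<^sub>i, e\<^sub>j) = (e\<^sub>i, e\<^sub>j\<^sub>0) + (0, e\<^sub>j - e\<^sub>j\<^sub>0)\<close>, so one generator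
    is saved because \<open>j = j0\<close> gives a zero second summand.\<close>
  define T :: "((real^'n) \<times> (real^'n)) set" where
    "T = (\<lambda>i. (axis i 1, axis j0 1)) ` fst ` F \<union> (\<lambda>j. (0, axis j 1 - axis j0 1)) ` (snd ` F - {j0})"
  have inj: "inj v"
    by (auto simp: inj_def v_def axis_eq_axis)
  have "v p \<in> span T" if "p \<in> F" for p
  proof -
    obtain i j where p: "p = (i, j)" by fastforce
    have i: "i \<in> fst ` F" and j: "j \<in> snd ` F"
      using that p by force+
    have 1: "(axis i 1, axis j0 1) \<in> span T"
      using i by (intro span_base) (simp add: T_def)
    have 2: "(0, axis j 1 - axis j0 1) \<in> span T"
    proof (cases "j = j0")
      case True
      then show ?thesis using span_zero[of T] by (simp add: zero_prod_def)
    next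
      case False
      then show ?thesis using j by (intro span_base) (simp add: T_def)
    qed
    show ?thesis
      using span_add[OF 1 2] by (simp add: p v_def)
  qed
  then have sub: "v ` F \<subseteq> span T" by blast
  have "dependent (v ` F)"
  proof (rule ccontr)
    assume "independent (v ` F)"
    then have "card (v ` F) \<le> card T"
      using independent_span_bound[OF _ _ sub] by (simp add: T_def)
    also have "card T \<le> card (fst ` F) + card (snd ` F - {j0})"
      unfolding T_def by (intro order_trans[OF card_Un_le] add_mono card_image_le) auto
    also have "\<dots> < card (fst ` F) + card (snd ` F)"
      using card_Diff1_less[OF _ j0] by simp
    also have "\<dots> \<le> card F" by (rule card)
    also have "card F = card (v ` F)"
      using inj by (simp add: card_image inj_on_subset)
    finally show False by simp
  qed
  then obtain u where u: "\<exists>q\<in>v ` F. u q \<noteq> 0" and sum0: "(\<Sum>q\<in>v ` F. u q *\<^sub>R q) = 0"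
    using dependent_finite[of "v ` F"] by auto
  define z :: "real^'n^'n" where "z = (\<chi> i j. if (i, j) \<in> F then u (v (i, j)) else 0)"
  have "(\<Sum>p\<in>F. u (v p) *\<^sub>R v p) = 0"
    using sum0 inj by (simp add: sum.reindex inj_on_subset)
  also have "(\<Sum>p\<in>F. u (v p) *\<^sub>R v p) = (\<Sum>p\<in>UNIV. (z $ fst p $ snd p) *\<^sub>R v p)"
    by (intro sum.mono_neutral_cong_left) (auto simp: z_def)
  also have "\<dots> = (\<Sum>i\<in>UNIV. \<Sum>j\<in>UNIV. (z $ i $ j) *\<^sub>R (axis i 1, axis j 1))"
    by (simp add: sum.cartesian_product v_def case_prod_beta)
  finally have Z: "(\<Sum>i\<in>UNIV. \<Sum>j\<in>UNIV. (z $ i $ j) *\<^sub>R (axis i (1::real), axis j (1::real))) = 0" .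
  have row: "(\<Sum>l\<in>UNIV. z $ i $ l) = 0" for i
  proof -
    have "0 = fst (\<Sum>i\<in>UNIV. \<Sum>j\<in>UNIV. (z $ i $ j) *\<^sub>R (axis i (1::real), axis j (1::real))) $ i"
      unfolding Z by simp
    also have "\<dots> = (\<Sum>k\<in>UNIV. \<Sum>j\<in>UNIV. if k = i then z $ k $ j else 0)"
      by (auto simp: fst_sum axis_def intro!: sum.cong)
    also have "\<dots> = (\<Sum>k\<in>UNIV. if k = i then (\<Sum>j\<in>UNIV. z $ k $ j) else 0)"
      by (intro sum.cong) auto
    finally show ?thesis by simp
  qed
  have col: "(\<Sum>l\<in>UNIV. z $ l $ j) = 0" for j
  proof -
    have "0 = snd (\<Sum>i\<in>UNIV. \<Sum>j\<in>UNIV. (z $ i $ j) *\<^sub>R (axis i (1::real), axis j (1::real))) $ j"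
      unfolding Z by simp
    also have "\<dots> = (\<Sum>i\<in>UNIV. \<Sum>k\<in>UNIV. if k = j then z $ i $ k else 0)"
      by (auto simp: snd_sum axis_def mult_delta_right intro!: sum.cong)
    finally show ?thesis by simp
  qed
  have "z \<noteq> 0"
  proof -
    obtain i j where ij: "(i, j) \<in> F" "u (v (i, j)) \<noteq> 0" using u by auto
    then have "z $ i $ j \<noteq> 0" by (simp add: z_def)
    then show ?thesis by auto
  qed
  then show ?thesis
    using row col by (intro that) (auto simp: support_def z_def split: if_splits)
qed

text \<open>A single non-integral summand cannot lead to the integral sum 1.\<close>

lemma two_fractional_entries:
  fixes a :: "'n::finite \<Rightarrow> real"
  assumes range: "0 \<le> a k" "a k \<le> 1" and sum: "(\<Sum>l\<in>UNIV. a l) = 1" and k: "a k \<notin> {0, 1}"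
  shows "2 \<le> card {l. a l \<notin> {0, 1}}"
proof (rule ccontr)
  assume "\<not> ?thesis"
  then have "card {l. a l \<notin> {0, 1}} \<le> card {k}" by simp
  moreover have "{k} \<subseteq> {l. a l \<notin> {0, 1}}" using k by auto
  ultimately have eq: "{l. a l \<notin> {0, 1}} = {k}"
    by (intro card_seteq[symmetric]) auto
  have "(\<Sum>l\<in>UNIV - {k}. a l) \<in> \<int>"
  proof (rule Ints_sum)
    fix l assume "l \<in> UNIV - {k}"
    then have "l \<notin> {l. a l \<notin> {0, 1}}" unfolding eq by simp
    then show "a l \<in> \<int>" by auto
  qed
  moreover have "a k = 1 - (\<Sum>l\<in>UNIV - {k}. a l)"
    using sum by (simp add: sum.remove[of _ k])
  ultimately have "a k \<in> \<int>" by simp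
  then obtain m where m: "a k = of_int m" by (auto elim: Ints_cases)
  with range have "0 \<le> m" "m \<le> 1" by auto
  then have "m = 0 \<or> m = 1" by arith
  then show False using k m by auto
qed

lemma vertex_entries:
  fixes v :: "real^'n^'n"
  assumes "v extreme_point_of birkhoff_polytope"
  shows "v $ i $ j \<in> {0, 1}"
proof (rule ccontr)
  assume frac: "v $ i $ j \<notin> {0, 1}"
  have v: "v \<in> birkhoff_polytope"
    using assms by (simp add: extreme_point_of_def)
  define F where "F = {(i, j). v $ i $ j \<notin> {0, 1}}"
  have rows: "2 * card (fst ` F) \<le> card F"
  proof -
    have "2 * card (fst ` F) = (\<Sum>i\<in>fst ` F. 2)" by simp
    also have "\<dots> \<le> (\<Sum>i\<in>fst ` F. card {j. (i, j) \<in> F})"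
    proof (rule sum_mono)
      fix i assume "i \<in> fst ` F"
      then show "2 \<le> card {j. (i, j) \<in> F}"
        using two_fractional_entries[OF birkhoffD(1,4)[OF v] birkhoffD(3)[OF v, of i]] by (auto simp: F_def)
    qed
    also have "\<dots> = card (SIGMA i:fst ` F. {j. (i, j) \<in> F})" by simp
    also have "(SIGMA i:fst ` F. {j. (i, j) \<in> F}) = F" by force
    finally show ?thesis .
  qed
  have cols: "2 * card (snd ` F) \<le> card F"
  proof -
    have "2 * card (snd ` F) = (\<Sum>j\<in>snd ` F. 2)" by simp
    also have "\<dots> \<le> (\<Sum>j\<in>snd ` F. card {i. (i, j) \<in> F})"
    proof (rule sum_mono)
      fix j assume "j \<in> snd ` F"
      then show "2 \<le> card {i. (i, j) \<in> F}"
        using two_fractional_entries[OF birkhoffD(1,4)[OF v] birkhoffD(2)[OF v, of j]] by (auto simp: F_def)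
    qed
    also have "\<dots> = card (SIGMA j:snd ` F. {i. (i, j) \<in> F})" by simp
    also have "\<dots> = card (prod.swap ` (SIGMA j:snd ` F. {i. (i, j) \<in> F}))"
      by (simp add: card_image)
    also have "prod.swap ` (SIGMA j:snd ` F. {i. (i, j) \<in> F}) = F" by force
    finally show ?thesis .
  qed
  have "F \<noteq> {}" using frac by (auto simp: F_def)
  then obtain z :: "real^'n^'n" where z: "z \<noteq> 0" "support z \<subseteq> F"
    "\<And>i. (\<Sum>l\<in>UNIV. z $ i $ l) = 0" "\<And>j. (\<Sum>l\<in>UNIV. z $ l $ j) = 0"
    using exists_zero_sum_matrix[of F] rows cols by auto
  have "support z \<subseteq> support v"
    using z(2) by (auto simp: F_def support_def)
  then obtain e where e: "e > 0" "\<And>i j. e * \<bar>z $ i $ j\<bar> \<le> v $ i $ j"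
    using exists_small_multiple[of v z] birkhoffD(1)[OF v] by auto
  have "v - e *\<^sub>R z \<noteq> v + e *\<^sub>R z"
  proof
    assume "v - e *\<^sub>R z = v + e *\<^sub>R z"
    then have "(2 * e) *\<^sub>R z = 0"
      by (simp add: scaleR_2 algebra_simps flip: scaleR_scaleR)
    then show False using e(1) z(1) by simp
  qed
  moreover have "midpoint (v - e *\<^sub>R z) (v + e *\<^sub>R z) = v"
    by (simp add: midpoint_def flip: scaleR_2)
  ultimately have "v \<in> open_segment (v - e *\<^sub>R z) (v + e *\<^sub>R z)"
    by (metis midpoint_in_open_segment)
  then show False
    using assms birkhoff_perturb[where e = e, OF v e z(3,4)] by (simp add: extreme_point_of_def)
qed

section \<open>Faces are determined by supports\<close>

text \<open>
  If \<open>v\<close> vanishes wherever \<open>x\<close> does, the segment from \<open>v\<close> to \<open>x\<close> can be prolonged beyond \<open>x\<close>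
  inside the polytope; then \<open>x\<close> is interior to a segment starting at \<open>v\<close>, and the face containing
  \<open>x\<close> contains \<open>v\<close>.
\<close>

lemma face_supportI:
  fixes x v :: "real^'n^'n"
  assumes face: "G face_of birkhoff_polytope" and x: "x \<in> G" and v: "v \<in> birkhoff_polytope"
    and sub: "support v \<subseteq> support x"
  shows "v \<in> G"
proof (cases "v = x")
  case False
  have x': "x \<in> birkhoff_polytope"
    using face x face_of_imp_subset by blast
  have "support (x - v) \<subseteq> support x"
    using sub unfolding support_def by auto (metis (mono_tags, lifting) case_prodD case_prodI mem_Collect_eq subsetD)
  then obtain e where e: "e > 0" "\<And>i j. e * \<bar>(x - v) $ i $ j\<bar> \<le> x $ i $ j"
    using exists_small_multiple[of x "x - v"] birkhoffD(1)[OF x'] by blast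
  define y where "y = x + e *\<^sub>R (x - v)"
  have y: "y \<in> birkhoff_polytope"
    unfolding y_def using birkhoffD[OF x'] birkhoffD[OF v]
    by (intro birkhoff_perturb[OF x' e]) (auto simp: sum_subtractf)
  have "x \<in> open_segment v y"
    unfolding in_segment
  proof (intro conjI exI[of _ "1 / (1 + e)"])
    show "v \<noteq> y"
    proof
      assume "v = y"
      then have "(1 + e) *\<^sub>R (x - v) = 0" by (simp add: y_def algebra_simps)
      then show False using e(1) False by simp
    qed
    have "1 - 1 / (1 + e) = e / (1 + e)" using e(1) by (simp add: field_simps)
    moreover have "(1 + e) *\<^sub>R x = e *\<^sub>R v + y" by (simp add: y_def algebra_simps)
    then have "(1 / (1 + e)) *\<^sub>R ((1 + e) *\<^sub>R x) = (1 / (1 + e)) *\<^sub>R (e *\<^sub>R v + y)" by simp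
    ultimately show "x = (1 - 1 / (1 + e)) *\<^sub>R v + (1 / (1 + e)) *\<^sub>R y"
      using e(1) by (simp add: scaleR_right_distrib)
  qed (use e(1) in auto)
  then show ?thesis
    using face v y x by (auto simp: face_of_def)
qed (use x in simp)

text \<open>
  A relative interior point works as \<open>x\<close>: the segment from any \<open>w \<in> G\<close> to it can be prolonged
  within \<open>G\<close>, and at an entry with \<open>x $ i $ j = 0\<close> and \<open>w $ i $ j > 0\<close> the prolongation would be
  negative.
\<close>

lemma face_max_support:
  assumes face: "G face_of (birkhoff_polytope :: (real^'n^'n) set)" and "G \<noteq> {}"
  obtains x where "x \<in> G" "G = {v \<in> birkhoff_polytope. support v \<subseteq> support x}"
proof -
  have conv: "convex G" using face by (rule face_of_imp_convex)
  then obtain x where x: "x \<in> rel_interior G"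
    using \<open>G \<noteq> {}\<close> rel_interior_eq_empty by blast
  have xG: "x \<in> G" using x rel_interior_subset by blast
  have sub: "G \<subseteq> birkhoff_polytope" using face by (rule face_of_imp_subset)
  have "support w \<subseteq> support x" if w: "w \<in> G" for w
  proof -
    obtain m where m: "m > 1" "(1 - m) *\<^sub>R w + m *\<^sub>R x \<in> G"
      using convex_rel_interior_iff[OF conv \<open>G \<noteq> {}\<close>] x w by auto
    have "w $ i $ j = 0" if "x $ i $ j = 0" for i j
    proof -
      have "0 \<le> ((1 - m) *\<^sub>R w + m *\<^sub>R x) $ i $ j"
        using m(2) sub birkhoffD(1) by blast
      then have "0 \<le> (1 - m) * w $ i $ j" using that by simp
      moreover have "0 \<le> w $ i $ j" using w sub birkhoffD(1) by blast
      ultimately show ?thesis using m(1) by (simp add: zero_le_mult_iff)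
    qed
    then show ?thesis by (auto simp: support_def)
  qed
  then show ?thesis
    using xG sub face_supportI[OF face xG] by (intro that[of x]) auto
qed

text \<open>Faces are determined by the support of a point, and there are finitely many supports.\<close>

lemma finite_faces_birkhoff: "finite (nonempty_faces (birkhoff_polytope :: (real^'n^'n) set))"
proof (rule finite_subset)
  show "nonempty_faces (birkhoff_polytope :: (real^'n^'n) set)
    \<subseteq> (\<lambda>P. {v \<in> birkhoff_polytope. support v \<subseteq> P}) ` UNIV"
  proof
    fix G assume "G \<in> nonempty_faces (birkhoff_polytope :: (real^'n^'n) set)"
    then have "G face_of birkhoff_polytope" "G \<noteq> {}" by (simp_all add: nonempty_faces_def)
    then obtain x where "G = {v \<in> birkhoff_polytope. support v \<subseteq> support x}"
      by (rule face_max_support)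
    then show "G \<in> (\<lambda>P. {v \<in> birkhoff_polytope. support v \<subseteq> P}) ` UNIV" by blast
  qed
qed simp

section \<open>Distance from a face to the opposite hull\<close>

lemma face_setdist:
  assumes "G \<in> nonempty_faces (birkhoff_polytope :: (real^'n^'n) set)" "G \<subset> birkhoff_polytope"
  shows "1 / sqrt ((real CARD('n))\<^sup>2 - 1) \<le> setdist G (opposite_hull birkhoff_polytope G)"
proof -
  let ?C = "birkhoff_polytope :: (real^'n^'n) set"
  have face: "G face_of ?C" and ne: "G \<noteq> {}"
    using assms(1) by (auto simp: nonempty_faces_def)
  obtain x where x: "x \<in> G" and G: "G = {v \<in> birkhoff_polytope. support v \<subseteq> support x}"
    using face_max_support[OF face ne] .
  have xC: "x \<in> ?C" using x assms(2) by blast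
  define w :: "real^'n^'n" where "w = (\<chi> i j. if (i, j) \<in> support x then 0 else 1)"
  have inner: "w \<bullet> y = (\<Sum>i\<in>UNIV. \<Sum>j\<in>UNIV. w $ i $ j * y $ i $ j)" for y
    by (simp add: inner_vec_def)
  have zero: "w \<bullet> y = 0" if "y \<in> G" for y
    unfolding inner using that
    by (intro sum.neutral ballI) (auto simp: w_def G support_def)
  have "w \<bullet> v \<ge> 1" if v: "v \<in> vertices ?C - G" for v
  proof -
    have ext: "v extreme_point_of ?C" and vC: "v \<in> ?C"
      using v by (auto simp: vertices_def extreme_point_of_def)
    obtain i j where ij: "(i, j) \<in> support v" "(i, j) \<notin> support x"
      using v vC by (auto simp: G)
    then have "v $ i $ j = 1"
      using vertex_entries[OF ext, of i j] by (auto simp: support_def)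
    then have "1 = w $ i $ j * v $ i $ j"
      using ij by (simp add: w_def)
    also have "\<dots> \<le> (\<Sum>j\<in>UNIV. w $ i $ j * v $ i $ j)"
      using birkhoffD(1)[OF vC] by (intro member_le_sum) (auto simp: w_def)
    also have "\<dots> \<le> w \<bullet> v"
      unfolding inner using birkhoffD(1)[OF vC]
      by (intro member_le_sum[of i UNIV "\<lambda>i. \<Sum>j\<in>UNIV. w $ i $ j * v $ i $ j"])
         (auto simp: w_def intro!: sum_nonneg)
    finally show ?thesis .
  qed
  then have "opposite_hull ?C G \<subseteq> {y. w \<bullet> y \<ge> 1}"
    unfolding opposite_hull_def by (intro hull_minimal) (auto simp: convex_halfspace_ge)
  then have far: "w \<bullet> y \<ge> 1" if "y \<in> opposite_hull ?C G" for y
    using that by blast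
  \<comment> \<open>The distance to the empty set is 0 by convention, so the hull must be seen to be nonempty.\<close>
  have opp: "opposite_hull ?C G \<noteq> {}"
  proof
    assume "opposite_hull ?C G = {}"
    then have "vertices ?C \<subseteq> G" by (simp add: opposite_hull_def)
    then have "convex hull vertices ?C \<subseteq> G"
      using face_of_imp_convex[OF face] by (rule hull_minimal)
    then show False
      using Krein_Milman_Minkowski[OF compact_birkhoff_polytope convex_birkhoff_polytope] assms(2)
      by (auto simp: vertices_def)
  qed
  have "(norm w)\<^sup>2 = (\<Sum>i\<in>UNIV. \<Sum>j\<in>UNIV. w $ i $ j * w $ i $ j)"
    by (simp add: power2_norm_eq_inner inner)
  also have "\<dots> \<le> (\<Sum>i\<in>(UNIV::'n set). \<Sum>j\<in>(UNIV::'n set). 1 - x $ i $ j)"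
    using birkhoffD(4)[OF xC] by (intro sum_mono) (auto simp: w_def support_def)
  also have "\<dots> = (real CARD('n))\<^sup>2 - real CARD('n)"
    by (simp add: sum_subtractf birkhoffD(3)[OF xC] power2_eq_square algebra_simps)
  also have "\<dots> \<le> (real CARD('n))\<^sup>2 - 1"
    by (simp add: Suc_le_eq)
  finally have "norm w \<le> sqrt ((real CARD('n))\<^sup>2 - 1)"
    by (rule real_le_rsqrt)
  moreover obtain y0 where "y0 \<in> opposite_hull ?C G" using opp by blast
  then have "w \<noteq> 0" using far[of y0] by auto
  ultimately have "1 / sqrt ((real CARD('n))\<^sup>2 - 1) \<le> 1 / norm w"
    using less_le_trans[of 0 "norm w" "sqrt ((real CARD('n))\<^sup>2 - 1)"]
    by (intro divide_left_mono mult_pos_pos) simp_all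
  also have "1 / norm w \<le> setdist G (opposite_hull ?C G)"
  proof (rule le_setdistI[OF ne opp])
    fix a b assume "a \<in> G" "b \<in> opposite_hull ?C G"
    then have "1 \<le> w \<bullet> (b - a)"
      using zero far by (simp add: inner_diff_right)
    also have "\<dots> \<le> norm w * dist a b"
      using norm_cauchy_schwarz[of w "b - a"] by (simp add: dist_norm norm_minus_commute)
    finally show "1 / norm w \<le> dist a b"
      using \<open>w \<noteq> 0\<close> by (simp add: field_simps)
  qed
  finally show ?thesis .
qed

text \<open>
  The minimum defining the facial distance must range over a nonempty set. One off-diagonal zero
  entry cuts out a face that contains the identity but not the uniform matrix.
\<close>

lemma exists_proper_face_birkhoff:
  assumes "CARD('n::finite) \<ge> 2"
  shows "{G \<in> nonempty_faces (birkhoff_polytope :: (real^'n^'n) set). G \<subset> birkhoff_polytope} \<noteq> {}"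
proof -
  let ?C = "birkhoff_polytope :: (real^'n^'n) set"
  obtain i j :: 'n where ij: "i \<noteq> j"
    using assms ex_card[OF assms] by (auto simp: card_2_iff)
  define G where "G = ?C \<inter> {x. axis i (axis j 1) \<bullet> x = 0}"
  have in_G: "x \<in> G \<longleftrightarrow> x \<in> ?C \<and> x $ i $ j = 0" for x
    by (simp add: G_def inner_axis')
  have "G face_of ?C"
    unfolding G_def using birkhoffD(1)
    by (intro face_of_Int_supporting_hyperplane_ge convex_birkhoff_polytope)
       (auto simp: inner_axis')
  moreover have "mat 1 \<in> G"
    using ij by (auto simp: in_G birkhoff_polytope_def mat_def)
  ultimately have "G \<in> nonempty_faces ?C"
    by (auto simp: nonempty_faces_def)
  moreover have "(\<chi> i j. 1 / real CARD('n)) \<in> ?C - G"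
    by (auto simp: in_G birkhoff_polytope_def)
  then have "G \<subset> ?C"
    by (auto simp: G_def)
  ultimately show ?thesis by blast
qed

theorem mainTheorem4:
  assumes "CARD('n::finite) \<ge> 3"
  shows "facial_distance (birkhoff_polytope :: (real^'n^'n) set)
           \<ge> 1 / sqrt ((real CARD('n))\<^sup>2 - 1)"
proof -
  let ?faces = "{G \<in> nonempty_faces (birkhoff_polytope :: (real^'n^'n) set). G \<subset> birkhoff_polytope}"
  have "finite ?faces"
    using finite_faces_birkhoff by (rule finite_subset[rotated]) blast
  moreover have "?faces \<noteq> {}"
    using assms by (intro exists_proper_face_birkhoff) simp
  ultimately show ?thesis
    unfolding facial_distance_def by (subst Min_ge_iff) (auto intro: face_setdist)
qed

end
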